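(* Assume that $\mathbb{S}(I)$ contains the identity map $\mathrm{id}_I$, and let $f,g\in T_{\mathbb{S}(I)}(X,\mathcal{P})$. Then $(f,g)\in \mathcal{R}$ in $T_{\mathbb{S}(I)}(X,\mathcal{P})$ if and only if $\left(\chi^{(f)},\chi^{(g)}\right)\in \mathcal{R}$ in $\mathbb{S}(I)$ and $\pi(f)=\pi(g)$.
   Context: $X$ is a nonempty set (possibly infinite) and $\mathcal{P}=\{X_i : i\in I\}$ is a partition of $X$ into nonempty blocks, with $X_i\cap X_j=\varnothing$ for $i\neq j$. $T(Z)$ denotes the semigroup of all maps $Z\to Z$ under composition. Maps are written on the right and composed from left to right: $x(fg)=(xf)g$; $Af=\{af: a\in A\}$. $T(X,\mathcal{P})$ is the subsemigroup of all $f\in T(X)$ such that for every $i\in I$ there is $j\in I$ with $X_if\subseteq X_j$. For $f\in T(X,\mathcal{P})$ the character $\chi^{(f)}\in T(I)$ is defined by $i\chi^{(f)}=j$ whenever $X_if\subseteq X_j$. For a subsemigroup $\mathbb{S}(I)$ of $T(I)$, $T_{\mathbb{S}(I)}(X,\mathcal{P})=\{f\in T(X,\mathcal{P}): \chi^{(f)}\in \mathbb{S}(I)\}$, a subsemigroup of $T(X,\mathcal{P})$; it contains $\mathrm{id}_X$ iff $\mathrm{id}_I\in\mathbb{S}(I)$. In a semigroup $S$ with identity, Green's relation $\mathcal{R}$ is: $(a,b)\in\mathcal{R}$ iff $aS=bS$. For $f\in T(X)$, $\ker(f)=\{(a,b)\in X\times X: af=bf\}$ and $\pi(f)$ is the partition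 of $X$ into $\ker(f)$-classes; thus $\pi(f)=\pi(g)$ iff $\ker(f)=\ker(g)$. *)

theory Defs
  imports "HOL-Algebra.Coset" "HOL-Library.Disjoint_Sets"
begin

text \<open>
  Maps \<open>Z \<rightarrow> Z\<close> are the extensional functions \<open>Z \<rightarrow>\<^sub>E Z\<close>, so that equality of
  maps is equality on \<open>Z\<close>. Maps are written on the right and composed from left to right:
  the product \<open>f \<otimes> g\<close> is ``first \<open>f\<close>, then \<open>g\<close>''.
\<close>

definition full_trans :: "'a set \<Rightarrow> ('a \<Rightarrow> 'a) monoid" where
  "full_trans Z = \<lparr>carrier = Z \<rightarrow>\<^sub>E Z, mult = (\<lambda>f g. compose Z g f), one = (\<lambda>x\<in>Z. x)\<rparr>"

definition subsemigroup :: "'a set \<Rightarrow> ('a, 'b) monoid_scheme \<Rightarrow> bool" where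
  "subsemigroup H M \<longleftrightarrow>
     H \<subseteq> carrier M \<and> (\<forall>x\<in>H. \<forall>y\<in>H. x \<otimes>\<^bsub>M\<^esub> y \<in> H)"

text \<open>The blocks of the partition are the sets \<open>P i\<close> with \<open>i \<in> I\<close>.\<close>

definition block_maps :: "'a set \<Rightarrow> 'i set \<Rightarrow> ('i \<Rightarrow> 'a set) \<Rightarrow> ('a \<Rightarrow> 'a) set" where
  "block_maps X I P =
     {f \<in> carrier (full_trans X). \<forall>i\<in>I. \<exists>j\<in>I. f ` P i \<subseteq> P j}"

text \<open>
  For \<open>f\<close> in \<open>block_maps X I P\<close>, the index \<open>j\<close> below exists, and it is unique because
  the blocks are nonempty and pairwise disjoint.
\<close>

definition character :: "'i set \<Rightarrow> ('i \<Rightarrow> 'a set) \<Rightarrow> ('a \<Rightarrow> 'a) \<Rightarrow> 'i \<Rightarrow> 'i" where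
  "character I P f = (\<lambda>i\<in>I. THE j. j \<in> I \<and> f ` P i \<subseteq> P j)"

definition char_trans ::
  "'a set \<Rightarrow> 'i set \<Rightarrow> ('i \<Rightarrow> 'a set) \<Rightarrow> ('i \<Rightarrow> 'i) set \<Rightarrow> ('a \<Rightarrow> 'a) monoid" where
  "char_trans X I P S =
     (full_trans X)\<lparr>carrier := {f \<in> block_maps X I P. character I P f \<in> S}\<rparr>"

text \<open>
  Green's relation in terms of principal right ideals \<open>aM\<close>; this is the form appropriate
  for semigroups with identity, where \<open>a\<close> lies in \<open>aM\<close>.
\<close>

definition green_R :: "('a, 'b) monoid_scheme \<Rightarrow> ('a \<times> 'a) set" where
  "green_R M =
     {(a, b). a \<in> carrier M \<and> b \<in> carrier M \<and>
        a <#\<^bsub>M\<^esub> carrier M = b <#\<^bsub>M\<^esub> carrier M}"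

definition ker_rel :: "'a set \<Rightarrow> ('a \<Rightarrow> 'b) \<Rightarrow> ('a \<times> 'a) set" where
  "ker_rel X f = {(a, b) \<in> X \<times> X. f a = f b}"

definition ker_partition :: "'a set \<Rightarrow> ('a \<Rightarrow> 'b) \<Rightarrow> 'a set set" where
  "ker_partition X f = X // ker_rel X f"

end

theory Submission
  imports Defs
begin

text \<open>
  Two elements of a monoid are \<open>\<R>\<close>-related iff each is a right multiple of the other, so
  everything reduces to deciding when \<open>f\<close> is a right multiple of \<open>g\<close>. Write \<open>T\<close> for the
  monoid of maps whose character \<open>\<chi>\<close> lies in \<open>S\<close>. The criterion is asymmetric: \<open>f \<in> gT\<close> iff \<open>\<chi>\<^sup>f \<in> \<chi>\<^sup>g S\<close> and \<open>ker g \<subseteq> ker f\<close>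
  (lemma \<open>right_multiple_iff\<close>).

  Necessity holds because the character is multiplicative and because equal values remain equal
  after composing with a further map. For sufficiency, let \<open>\<chi>\<^sup>f\<close> be
  \<open>\<chi>\<^sup>g\<close> followed by \<open>a \<in> S\<close>. The kernel inclusion makes the assignment
  \<open>yg \<mapsto> yf\<close> a well-defined map on the image of \<open>g\<close>, and it sends points of the
  block \<open>X\<^sub>j\<close> into \<open>X\<^bsub>ja\<^esub>\<close>: if \<open>y \<in> X\<^sub>i\<close> and \<open>yg \<in> X\<^sub>j\<close>, then
  \<open>j\<close> is the image of \<open>i\<close> under \<open>\<chi>\<^sup>g\<close>, so \<open>yf\<close> lies in the block
  indexed by the image of \<open>i\<close> under \<open>\<chi>\<^sup>f\<close>, which is \<open>ja\<close>. Off the image of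
  \<open>g\<close> the map is extended by sending each point of \<open>X\<^sub>j\<close> to an arbitrary point of the
  nonempty block \<open>X\<^bsub>ja\<^esub>\<close>. The extension has character \<open>a\<close>, hence belongs to the
  monoid, and it carries \<open>g\<close> to \<open>f\<close>.

  Using the criterion in both directions gives the theorem, since a partition into kernel classes
  determines the kernel (lemma \<open>ker_partition_eq_iff\<close>).
\<close>

lemma (in monoid) green_R_iff:
  assumes a: "a \<in> carrier G" and b: "b \<in> carrier G"
  shows "(a, b) \<in> green_R G \<longleftrightarrow>
    (\<exists>h\<in>carrier G. a = b \<otimes> h) \<and> (\<exists>h\<in>carrier G. b = a \<otimes> h)"
proof -
  have mem: "x \<in> y <# carrier G \<longleftrightarrow> (\<exists>h\<in>carrier G. x = y \<otimes> h)" for x y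
    by (auto simp: l_coset_def)
  have self: "x \<in> x <# carrier G" if "x \<in> carrier G" for x
    using that by (metis mem one_closed r_one)
  have absorb: "x <# carrier G \<subseteq> y <# carrier G"
    if "y \<in> carrier G" "x \<in> y <# carrier G" for x y
    using that by (auto simp: mem m_assoc) (metis m_assoc m_closed)
  show ?thesis
    using a b self absorb mem by (auto simp: green_R_def)
qed

lemma ker_rel_from_ker_partition: "ker_rel X f = (\<Union>C\<in>ker_partition X f. C \<times> C)"
  by (auto simp: ker_partition_def ker_rel_def quotient_def)

lemma ker_partition_eq_iff:
  "ker_partition X f = ker_partition X g \<longleftrightarrow> ker_rel X f = ker_rel X g"
proof
  assume "ker_partition X f = ker_partition X g"
  then show "ker_rel X f = ker_rel X g"
    by (simp add: ker_rel_from_ker_partition)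
qed (simp add: ker_partition_def)

lemma carrier_full_trans [simp]: "carrier (full_trans Z) = Z \<rightarrow>\<^sub>E Z"
  by (simp add: full_trans_def)

lemma mult_full_trans [simp]: "f \<otimes>\<^bsub>full_trans Z\<^esub> g = compose Z g f"
  by (simp add: full_trans_def)

lemma one_full_trans [simp]: "\<one>\<^bsub>full_trans Z\<^esub> = (\<lambda>x\<in>Z. x)"
  by (simp add: full_trans_def)

lemma monoid_full_trans: "monoid (full_trans Z)"
proof (rule monoidI)
  fix f g h
  assume "f \<in> carrier (full_trans Z)" "g \<in> carrier (full_trans Z)" "h \<in> carrier (full_trans Z)"
  then show "f \<otimes>\<^bsub>full_trans Z\<^esub> g \<otimes>\<^bsub>full_trans Z\<^esub> h =
      f \<otimes>\<^bsub>full_trans Z\<^esub> (g \<otimes>\<^bsub>full_trans Z\<^esub> h)"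
    by (auto simp: compose_def fun_eq_iff)
qed (auto simp: compose_def fun_eq_iff PiE_def Pi_def extensional_def)

lemma monoid_subsemigroup:
  assumes "monoid M" "subsemigroup H M" "\<one>\<^bsub>M\<^esub> \<in> H"
  shows "monoid (M\<lparr>carrier := H\<rparr>)"
  using assms
  by (intro submonoid.submonoid_is_monoid submonoid.intro) (auto simp: subsemigroup_def)

locale indexed_partition =
  fixes X :: "'a set" and I :: "'i set" and P :: "'i \<Rightarrow> 'a set"
  assumes partition: "partition_on X (P ` I)"
    and disjoint: "disjoint_family_on P I"
begin

lemma block_subset: "i \<in> I \<Longrightarrow> P i \<subseteq> X"
  using partition by (auto simp: partition_on_def)

lemma block_nonempty: "i \<in> I \<Longrightarrow> P i \<noteq> {}"
  using partition by (auto simp: partition_on_def)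

lemma block_cover: "x \<in> X \<Longrightarrow> \<exists>i\<in>I. x \<in> P i"
  using partition by (auto simp: partition_on_def)

lemma block_unique: "\<lbrakk>i \<in> I; j \<in> I; x \<in> P i; x \<in> P j\<rbrakk> \<Longrightarrow> i = j"
  using disjoint by (auto simp: disjoint_family_on_def)

lemma character_eqI:
  assumes "i \<in> I" "j \<in> I" "f ` P i \<subseteq> P j"
  shows "character I P f i = j"
proof -
  have "(THE j. j \<in> I \<and> f ` P i \<subseteq> P j) = j"
  proof (rule the_equality)
    fix k assume "k \<in> I \<and> f ` P i \<subseteq> P k"
    then show "k = j"
      using assms block_nonempty[of i] block_unique[of k j] by blast
  qed (use assms in auto)
  then show ?thesis
    using assms by (simp add: character_def)
qed

lemma character_in_index:
  assumes "f \<in> block_maps X I P" "i \<in> I"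
  shows "character I P f i \<in> I"
  using assms character_eqI by (force simp: block_maps_def)

lemma character_block:
  assumes "f \<in> block_maps X I P" "i \<in> I" "x \<in> P i"
  shows "f x \<in> P (character I P f i)"
proof -
  obtain j where "j \<in> I" "f ` P i \<subseteq> P j"
    using assms by (auto simp: block_maps_def)
  then show ?thesis
    using assms character_eqI by blast
qed

lemma character_eq_extI:
  assumes "a \<in> I \<rightarrow>\<^sub>E I" "\<And>i x. i \<in> I \<Longrightarrow> x \<in> P i \<Longrightarrow> f x \<in> P (a i)"
  shows "character I P f = a"
proof
  fix i
  show "character I P f i = a i"
  proof (cases "i \<in> I")
    case True
    then show ?thesis
      using assms by (intro character_eqI) auto
  next
    case False
    then show ?thesis
      using assms(1) by (simp add: character_def PiE_arb[OF assms(1)])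
  qed
qed

lemma block_maps_compose:
  assumes f: "f \<in> block_maps X I P" and g: "g \<in> block_maps X I P"
  shows "compose X g f \<in> block_maps X I P"
    and "character I P (compose X g f) = compose I (character I P g) (character I P f)"
proof -
  have maps: "compose X g f x \<in> P (compose I (character I P g) (character I P f) i)"
    if "i \<in> I" "x \<in> P i" for i x
    using that f g block_subset[of i]
    by (auto simp: compose_def intro!: character_block character_in_index)
  have char: "compose I (character I P g) (character I P f) \<in> I \<rightarrow>\<^sub>E I"
    using f g by (auto simp: compose_def intro!: character_in_index)
  show "character I P (compose X g f) = compose I (character I P g) (character I P f)"
    using char maps by (rule character_eq_extI)
  have "compose X g f \<in> X \<rightarrow>\<^sub>E X"
    using f g by (auto simp: block_maps_def compose_def)
  moreover have "\<exists>j\<in>I. compose X g f ` P i \<subseteq> P j" if "i \<in> I" for i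
    using that maps PiE_mem[OF char] by blast
  ultimately show "compose X g f \<in> block_maps X I P"
    by (simp add: block_maps_def)
qed

lemma block_maps_one:
  shows "(\<lambda>x\<in>X. x) \<in> block_maps X I P"
    and "character I P (\<lambda>x\<in>X. x) = (\<lambda>i\<in>I. i)"
proof -
  have "(\<lambda>x\<in>X. x) ` P i \<subseteq> P i" if "i \<in> I" for i
    using that block_subset by auto
  then show "(\<lambda>x\<in>X. x) \<in> block_maps X I P"
    by (auto simp: block_maps_def)
  show "character I P (\<lambda>x\<in>X. x) = (\<lambda>i\<in>I. i)"
    using block_subset by (intro character_eq_extI) auto
qed

lemma monoid_char_trans:
  assumes "subsemigroup S (full_trans I)" "\<one>\<^bsub>full_trans I\<^esub> \<in> S"
  shows "monoid (char_trans X I P S)"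
  unfolding char_trans_def
proof (rule monoid_subsemigroup[OF monoid_full_trans])
  show "subsemigroup {f \<in> block_maps X I P. character I P f \<in> S} (full_trans X)"
    using assms(1) block_maps_compose by (auto simp: subsemigroup_def block_maps_def)
  show "\<one>\<^bsub>full_trans X\<^esub> \<in> {f \<in> block_maps X I P. character I P f \<in> S}"
    using assms(2) block_maps_one by simp
qed

text \<open>
  The extension argument: a factorization of characters, together with an inclusion of kernels,
  lifts to a factorization of the maps themselves. The value at a point of the image of \<open>g\<close> is
  forced; elsewhere any point of the block prescribed by \<open>a\<close> will do.
\<close>

lemma lift_character_factor:
  assumes f: "f \<in> block_maps X I P" and g: "g \<in> block_maps X I P"
    and a: "a \<in> I \<rightarrow>\<^sub>E I"
    and char: "character I P f = compose I a (character I P g)"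
    and ker: "ker_rel X g \<subseteq> ker_rel X f"
  obtains h where "h \<in> block_maps X I P" "character I P h = a" "f = compose X h g"
proof -
  have f_fun: "f \<in> X \<rightarrow>\<^sub>E X" and g_fun: "g \<in> X \<rightarrow>\<^sub>E X"
    using f g by (simp_all add: block_maps_def)
  have "\<exists>z. (\<forall>y\<in>X. g y = x \<longrightarrow> z = f y) \<and> (\<forall>j\<in>I. x \<in> P j \<longrightarrow> z \<in> P (a j))"
    if x: "x \<in> X" for x
  proof (cases "x \<in> g ` X")
    case True
    then obtain y where y: "y \<in> X" "g y = x"
      by auto
    have "f y \<in> P (a j)" if "j \<in> I" "x \<in> P j" for j
    proof -
      obtain i where i: "i \<in> I" "y \<in> P i"
        using block_cover y(1) by blast
      then have "character I P g i = j"
        using that y(2) character_block[OF g] character_in_index[OF g] block_unique by blast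
      then have "character I P f i = a j"
        using i char by (simp add: compose_def)
      then show ?thesis
        using character_block[OF f i] by simp
    qed
    moreover have "f y = f y'" if "y' \<in> X" "g y' = x" for y'
      using ker y that by (auto simp: ker_rel_def)
    ultimately show ?thesis
      by metis
  next
    case False
    obtain i where i: "i \<in> I" "x \<in> P i"
      using block_cover x by blast
    then obtain z where "z \<in> P (a i)"
      using block_nonempty PiE_mem[OF a] by blast
    then show ?thesis
      using False i block_unique by blast
  qed
  then obtain k where on_image: "\<And>y. y \<in> X \<Longrightarrow> g y \<in> X \<Longrightarrow> k (g y) = f y"
    and on_block: "\<And>x j. x \<in> X \<Longrightarrow> j \<in> I \<Longrightarrow> x \<in> P j \<Longrightarrow> k x \<in> P (a j)"
    by metis
  define h where "h = restrict k X"
  have maps: "h x \<in> P (a j)" if "j \<in> I" "x \<in> P j" for j x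
    using that on_block block_subset by (auto simp: h_def)
  have "h x \<in> X" if "x \<in> X" for x
    using that maps block_cover block_subset PiE_mem[OF a] by blast
  then have "h \<in> X \<rightarrow>\<^sub>E X"
    by (auto simp: h_def)
  moreover have "\<exists>j\<in>I. h ` P i \<subseteq> P j" if "i \<in> I" for i
    using that maps PiE_mem[OF a] by blast
  ultimately have "h \<in> block_maps X I P"
    by (simp add: block_maps_def)
  moreover have "character I P h = a"
    using a maps by (rule character_eq_extI)
  moreover have "f = compose X h g"
  proof
    fix x
    show "f x = compose X h g x"
      using on_image PiE_mem[OF g_fun] PiE_arb[OF f_fun]
      by (cases "x \<in> X") (simp_all add: compose_def h_def)
  qed
  ultimately show thesis
    by (rule that)
qed

lemma right_multiple_iff:
  assumes S: "S \<subseteq> carrier (full_trans I)"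
    and f: "f \<in> carrier (char_trans X I P S)" and g: "g \<in> carrier (char_trans X I P S)"
  shows "(\<exists>h\<in>carrier (char_trans X I P S). f = g \<otimes>\<^bsub>char_trans X I P S\<^esub> h) \<longleftrightarrow>
    (\<exists>a\<in>S. character I P f = character I P g \<otimes>\<^bsub>full_trans I\<^esub> a) \<and>
    ker_rel X g \<subseteq> ker_rel X f"
    (is "?multiple \<longleftrightarrow> ?factor")
proof
  assume ?multiple
  then obtain h where h: "h \<in> block_maps X I P" "character I P h \<in> S" "f = compose X h g"
    by (auto simp: char_trans_def)
  have "character I P f = compose I (character I P h) (character I P g)"
    using g h block_maps_compose(2) by (simp add: char_trans_def)
  moreover have "ker_rel X g \<subseteq> ker_rel X f"
    by (auto simp: h(3) ker_rel_def compose_def)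
  ultimately show ?factor
    using h(2) by auto
next
  assume ?factor
  then obtain a where a: "a \<in> S" "character I P f = compose I a (character I P g)"
    and ker: "ker_rel X g \<subseteq> ker_rel X f"
    by auto
  moreover have "f \<in> block_maps X I P" "g \<in> block_maps X I P" "a \<in> I \<rightarrow>\<^sub>E I"
    using f g a(1) S by (auto simp: char_trans_def)
  ultimately obtain h where "h \<in> block_maps X I P" "character I P h = a" "f = compose X h g"
    using lift_character_factor by blast
  then show ?multiple
    using a(1) by (auto simp: char_trans_def)
qed

end

theorem theorem5p6:
  fixes X :: "'a set" and I :: "'i set" and P :: "'i \<Rightarrow> 'a set"
    and S :: "('i \<Rightarrow> 'i) set" and f g :: "'a \<Rightarrow> 'a"
  assumes "X \<noteq> {}"
    and "partition_on X (P ` I)"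
    and "disjoint_family_on P I"
    and "subsemigroup S (full_trans I)"
    and "\<one>\<^bsub>full_trans I\<^esub> \<in> S"
    and "f \<in> carrier (char_trans X I P S)"
    and "g \<in> carrier (char_trans X I P S)"
  shows "(f, g) \<in> green_R (char_trans X I P S) \<longleftrightarrow>
    (character I P f, character I P g) \<in> green_R ((full_trans I)\<lparr>carrier := S\<rparr>) \<and>
    ker_partition X f = ker_partition X g"
proof -
  interpret indexed_partition X I P
    using assms(2,3) by unfold_locales
  have S: "S \<subseteq> carrier (full_trans I)"
    using assms(4) by (simp add: subsemigroup_def)
  have "character I P f \<in> S" "character I P g \<in> S"
    using assms(6,7) by (simp_all add: char_trans_def)
  then have char_R: "(character I P f, character I P g) \<in> green_R ((full_trans I)\<lparr>carrier := S\<rparr>) \<longleftrightarrow>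
      (\<exists>a\<in>S. character I P f = character I P g \<otimes>\<^bsub>full_trans I\<^esub> a) \<and>
      (\<exists>a\<in>S. character I P g = character I P f \<otimes>\<^bsub>full_trans I\<^esub> a)"
    using monoid.green_R_iff[OF monoid_subsemigroup[OF monoid_full_trans assms(4,5)]] by simp
  show ?thesis
    unfolding monoid.green_R_iff[OF monoid_char_trans[OF assms(4,5)] assms(6,7)] char_R
      right_multiple_iff[OF S assms(6,7)] right_multiple_iff[OF S assms(7,6)]
      ker_partition_eq_iff
    by blast
qed

end
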